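(* Let $n,\lambda\in\mathbb{N}$ and let $\mathcal{H}=\{H_1,\dots,H_m\}$ be a bipartite covering of the multigraph $K_n^{\lambda}$. Then $${\rm cap}(\mathcal{H}) \geq \max\left\{2 \lambda (n-1), \enspace n\left( \log n + \left\lfloor \frac{\lambda - 1}{2} \right\rfloor \log \left(\frac{\log n}{\lambda} \right) - \lambda -1 \right)\right\}.$$
   Context: All logarithms are to base $2$. $K_n^{\lambda}$ denotes the complete multigraph on an $n$-element vertex set $V$ in which every pair of distinct vertices is joined by an edge of multiplicity $\lambda$. For a multigraph $G$, a bipartite covering of $G$ is a finite collection $\mathcal{H}=\{H_1,\dots,H_m\}$ of (simple) bipartite graphs with $V(H_i)\subseteq V(G)$ such that for every pair $e$ of vertices joined in $G$ with multiplicity $\mu$, there are at least $\mu$ distinct indices $i\in[m]$ with $e\in E(H_i)$. The capacity is ${\rm cap}(\mathcal{H})=\sum_{i=1}^m |H_i|$, where $|H_i|$ is the number of vertices of $H_i$. *)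

theory Defs
  imports Complex_Main "HOL-Library.Ramsey"
begin

text \<open>Edges are 2-element vertex sets; \<open>[V]\<^bsup>2\<^esup>\<close> is the set of all 2-element subsets of \<open>V\<close>.\<close>

record 'a graph =
  gverts :: "'a set"
  gedges :: "'a set set"

record 'a multigraph =
  mverts :: "'a set"
  mmult :: "'a set \<Rightarrow> nat"

definition simple_graph :: "'a graph \<Rightarrow> bool" where
  "simple_graph H \<longleftrightarrow> finite (gverts H) \<and> gedges H \<subseteq> [gverts H]\<^bsup>2\<^esup>"

definition bipartite_graph :: "'a graph \<Rightarrow> bool" where
  "bipartite_graph H \<longleftrightarrow> simple_graph H \<and>
     (\<exists>A B. A \<union> B = gverts H \<and> A \<inter> B = {} \<and>
        (\<forall>e\<in>gedges H. \<exists>a\<in>A. \<exists>b\<in>B. e = {a, b}))"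

definition complete_multigraph :: "'a set \<Rightarrow> nat \<Rightarrow> 'a multigraph" where
  "complete_multigraph V l =
     \<lparr>mverts = V, mmult = (\<lambda>e. if e \<in> [V]\<^bsup>2\<^esup> then l else 0)\<rparr>"

text \<open>A collection \<open>H\<^sub>1, \<dots>, H\<^sub>m\<close> is an indexed family, of which only the
  indices in \<open>{1..m}\<close> matter; repetitions are allowed and counted by index.\<close>

definition bipartite_covering :: "'a multigraph \<Rightarrow> nat \<Rightarrow> (nat \<Rightarrow> 'a graph) \<Rightarrow> bool" where
  "bipartite_covering G m H \<longleftrightarrow>
     (\<forall>i\<in>{1..m}. bipartite_graph (H i) \<and> gverts (H i) \<subseteq> mverts G) \<and>
     (\<forall>e\<in>[mverts G]\<^bsup>2\<^esup>. mmult G e \<le> card {i\<in>{1..m}. e \<in> gedges (H i)})"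

definition capacity :: "nat \<Rightarrow> (nat \<Rightarrow> 'a graph) \<Rightarrow> nat" where
  "capacity m H = (\<Sum>i=1..m. card (gverts (H i)))"

end

theory Submission
  imports Defs
begin

text \<open>
  Both bounds are double counts. For the first, a bipartite graph on \<open>k \<le> n\<close> vertices has at most
  \<open>k\<^sup>2 / 4 \<le> k n / 4\<close> edges, and at least \<open>\<lambda> n (n - 1) / 2\<close> edges must be covered.

  For the second, fix a bipartition of every \<open>H\<^sub>i\<close> and read each vertex \<open>v\<close> as a partial 0-1 word of
  length \<open>m\<close>, defined at the \<open>d v\<close> indices \<open>i\<close> with \<open>v \<in> V(H\<^sub>i)\<close>. Two distinct vertices disagree in at
  least \<open>\<lambda>\<close> positions where both are defined, so with \<open>t = \<lfloor>(\<lambda> - 1) / 2\<rfloor>\<close> no full word is within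
  \<open>t\<close> errors of both. Packing these Hamming balls into the cube gives \<open>\<Sum>v. f (d v) \<le> 1\<close>, where
  \<open>f d = 2\<^sup>-\<^sup>d (\<Sum>j\<le>t. d choose j)\<close>. The function \<open>f\<close> is convex on the integers \<open>d \<ge> 2 t - 1\<close>, a range
  containing all \<open>d v \<ge> \<lambda>\<close>, so if \<open>k\<close> is the integer part of the average of \<open>d\<close>, then
  \<open>f (k + 1) \<le> 1 / n\<close>. Finally \<open>(k + 1) choose t \<ge> ((k + 1) / t)\<^sup>t\<close>.
\<close>

section \<open>Convexity of the lower binomial tail\<close>

text \<open>The probability that \<open>d\<close> fair coin flips show at most \<open>t\<close>
  heads; equivalently, the share of the cube filled by a radius-\<open>t\<close> ball around a word
  with \<open>d\<close> defined positions.\<close>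

definition binomial_tail :: "nat \<Rightarrow> nat \<Rightarrow> real" where
  "binomial_tail t d = (\<Sum>j\<le>t. real (d choose j)) / 2 ^ d"

lemma sum_choose_Suc:
  "(\<Sum>j\<le>t. real (Suc d choose j)) = 2 * (\<Sum>j\<le>t. real (d choose j)) - real (d choose t)"
  by (induction t) auto

lemma binomial_tail_Suc:
  "binomial_tail t (Suc d) = binomial_tail t d - real (d choose t) / 2 ^ Suc d"
  unfolding binomial_tail_def sum_choose_Suc by (simp add: field_simps)

text \<open>By Pascal's rule this reduces to \<open>d choose (t - 1)\<close> \<le>
  \<open>d choose t\<close>. Below the middle that is monotonicity; at \<open>d = 2 * t - 1\<close>
  the two are equal by symmetry.\<close>

lemma choose_Suc_le_double:
  assumes "2 * t \<le> Suc d"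
  shows "Suc d choose t \<le> 2 * (d choose t)"
proof (cases t)
  case (Suc s)
  have "d choose s \<le> d choose t"
  proof (cases "Suc d = 2 * t")
    case True
    then show ?thesis
      using binomial_symmetric[of s d] Suc by simp
  next
    case False
    then show ?thesis
      using assms Suc by (intro binomial_mono) auto
  qed
  then show ?thesis
    using Suc by simp
qed simp

text \<open>This is the convexity: the decrements of \<open>binomial_tail t\<close> shrink, because
  the numerator at most doubles while the denominator exactly doubles.\<close>

lemma binomial_tail_step_antimono:
  assumes "2 * t \<le> Suc k" and "k \<le> d"
  shows "real (d choose t) / 2 ^ Suc d \<le> real (k choose t) / 2 ^ Suc k"
  using assms(2)
proof (induction d rule: dec_induct)
  case (step d)
  have "real (Suc d choose t) \<le> 2 * real (d choose t)"
    using choose_Suc_le_double[of t d] assms(1) step.hyps by linarith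
  then have "real (Suc d choose t) / 2 ^ Suc (Suc d) \<le> real (d choose t) / 2 ^ Suc d"
    by (simp add: field_simps)
  then show ?case
    using step.IH by linarith
qed simp

lemma binomial_tail_tangent:
  assumes "2 * t \<le> Suc k" and "2 * t \<le> Suc d"
  shows "binomial_tail t d \<ge>
    binomial_tail t k - (real d - real k) * (real (k choose t) / 2 ^ Suc k)"
proof -
  define g where "g e = real (e choose t) / 2 ^ Suc e" for e
  have tail: "binomial_tail t (Suc e) = binomial_tail t e - g e" for e
    unfolding g_def by (rule binomial_tail_Suc)
  have anti: "g e \<le> g c" if "2 * t \<le> Suc c" "c \<le> e" for c e
    unfolding g_def using that by (rule binomial_tail_step_antimono)
  have "binomial_tail t k - (real d - real k) * g k \<le> binomial_tail t d"
  proof (cases "k \<le> d")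
    case True
    then show ?thesis
    proof (induction d rule: dec_induct)
      case (step e)
      then show ?case
        using anti[of k e] assms(1) by (simp add: tail algebra_simps)
    qed simp
  next
    case False
    then have "d \<le> k" by simp
    then show ?thesis
    \<comment> \<open>Walking down from \<open>k\<close>, every decrement met is at least
      \<open>g k\<close>; the bound on \<open>d\<close> keeps the walk inside the convex
      range.\<close>
    proof (induction d rule: inc_induct)
      case (step e)
      have "2 * t \<le> Suc e"
        using assms(2) step.hyps by simp
      then show ?case
        using anti[of e k] step by (simp add: tail algebra_simps)
    qed simp
  qed
  then show ?thesis
    unfolding g_def .
qed

text \<open>Jensen's inequality via the tangent at the rounded-down average \<open>k\<close>. The
  degrees exceed \<open>k\<close> by less than 1 on average, so rounding costs at most one decrement
  per vertex, which turns \<open>k\<close> into \<open>Suc k\<close>.\<close>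

lemma card_mult_binomial_tail_le_sum:
  assumes "finite V" and "V \<noteq> {}"
    and d: "\<And>v. v \<in> V \<Longrightarrow> 2 * t \<le> d v"
    and k: "k = (\<Sum>v\<in>V. d v) div card V"
  shows "real (card V) * binomial_tail t (Suc k) \<le> (\<Sum>v\<in>V. binomial_tail t (d v))"
proof -
  let ?n = "real (card V)" and ?g = "real (k choose t) / 2 ^ Suc k"
  let ?s = "\<Sum>v\<in>V. d v"
  have n: "card V > 0"
    using assms by (simp add: card_gt_0_iff)
  have "card V * (2 * t) \<le> ?s"
    using sum_bounded_below[of V "2 * t" d] d by simp
  then have "2 * t \<le> k"
    unfolding k using n by (simp add: less_eq_div_iff_mult_less_eq mult.commute)
  have "?s < card V * Suc k"
    unfolding k using n dividend_less_times_div[of "card V" ?s] by simp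
  then have s: "real ?s \<le> ?n * real (Suc k)"
    by (metis less_imp_le of_nat_le_iff of_nat_mult)
  have "?n * binomial_tail t (Suc k) = ?n * binomial_tail t k - ?n * ?g"
    by (simp add: binomial_tail_Suc algebra_simps)
  also have "\<dots> \<le> ?n * binomial_tail t k - (real ?s - ?n * real k) * ?g"
  proof -
    have "(real ?s - ?n * real k) * ?g \<le> ?n * ?g"
      by (rule mult_right_mono) (use s in \<open>auto simp: algebra_simps\<close>)
    then show ?thesis by simp
  qed
  also have "\<dots> = (\<Sum>v\<in>V. binomial_tail t k - (real (d v) - real k) * ?g)"
    by (simp only: sum_subtractf sum_distrib_right[symmetric] sum_constant of_nat_sum)
  also have "\<dots> \<le> (\<Sum>v\<in>V. binomial_tail t (d v))"
    by (rule sum_mono, rule binomial_tail_tangent) (use \<open>2 * t \<le> k\<close> d in fastforce)+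
  finally show ?thesis .
qed

section \<open>Hamming balls around partial words\<close>

text \<open>A partial word is given by its domain \<open>D\<close> and the set \<open>A \<subseteq> D\<close> of positions carrying a 1.\<close>

definition partial_ball :: "'i set \<Rightarrow> nat \<Rightarrow> 'i set \<Rightarrow> 'i set \<Rightarrow> 'i set set" where
  "partial_ball I t D A = {W. W \<subseteq> I \<and> card (sym_diff W A \<inter> D) \<le> t}"

lemma card_subsets_le:
  assumes "finite D"
  shows "card {X. X \<subseteq> D \<and> card X \<le> t} = (\<Sum>j\<le>t. card D choose j)"
proof -
  have "{X. X \<subseteq> D \<and> card X \<le> t} = (\<Union>j\<le>t. {X. X \<subseteq> D \<and> card X = j})"
    by auto
  also have "card \<dots> = (\<Sum>j\<le>t. card {X. X \<subseteq> D \<and> card X = j})"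
    using assms by (intro card_UN_disjoint) auto
  finally show ?thesis
    using assms by (simp add: n_subsets)
qed

text \<open>A word in the ball is built from its error set \<open>X\<close> inside \<open>D\<close>
  and its free bits \<open>Y\<close> outside \<open>D\<close>.\<close>

lemma card_partial_ball_ge:
  assumes "finite I" and "D \<subseteq> I" and "A \<subseteq> D"
  shows "2 ^ card I * binomial_tail t (card D) \<le> real (card (partial_ball I t D A))"
proof -
  let ?S = "{X. X \<subseteq> D \<and> card X \<le> t}"
  let ?f = "\<lambda>(X, Y). sym_diff X A \<union> Y"
  have D: "finite D"
    using assms finite_subset by blast
  have inj: "inj_on ?f (?S \<times> Pow (I - D))"
  proof (rule inj_on_inverseI)
    fix p assume "p \<in> ?S \<times> Pow (I - D)"
    then show "(\<lambda>W. (sym_diff W A \<inter> D, W - D)) (?f p) = p"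
      using assms(3) by auto
  qed
  have sub: "?f ` (?S \<times> Pow (I - D)) \<subseteq> partial_ball I t D A"
  proof (clarsimp simp: partial_ball_def, intro conjI)
    fix X Y assume *: "X \<subseteq> D" "card X \<le> t" "Y \<subseteq> I - D"
    show "X - A \<subseteq> I" "A - X \<subseteq> I" "Y \<subseteq> I"
      using * assms by auto
    have "sym_diff (sym_diff X A \<union> Y) A \<inter> D = X"
      using * assms by auto
    then show "card (sym_diff (sym_diff X A \<union> Y) A \<inter> D) \<le> t"
      using * by simp
  qed
  have "finite (partial_ball I t D A)"
    using assms(1) by (simp add: partial_ball_def)
  then have "card (?S \<times> Pow (I - D)) \<le> card (partial_ball I t D A)"
    using card_inj_on_le[OF inj sub] by simp
  moreover have "card (?S \<times> Pow (I - D)) = (\<Sum>j\<le>t. card D choose j) * 2 ^ (card I - card D)"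
    using assms D by (simp add: card_cartesian_product card_subsets_le card_Pow card_Diff_subset)
  moreover have "(2::real) ^ card I = 2 ^ card D * 2 ^ (card I - card D)"
    using card_mono[OF assms(1,2)] by (simp flip: power_add)
  then have "2 ^ card I * binomial_tail t (card D) =
      real ((\<Sum>j\<le>t. card D choose j) * 2 ^ (card I - card D))"
    by (simp add: binomial_tail_def)
  ultimately show ?thesis
    by linarith
qed

text \<open>Where \<open>A\<close> and \<open>A'\<close> differ on both domains, a common word
  \<open>W\<close> errs against one of them, so at most \<open>2 * t\<close> such positions could
  exist.\<close>

lemma partial_balls_disjoint:
  assumes "finite I" and "D \<subseteq> I" and "D' \<subseteq> I"
    and far: "2 * t < card (sym_diff A A' \<inter> D \<inter> D')"
  shows "partial_ball I t D A \<inter> partial_ball I t D' A' = {}"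
proof (rule ccontr)
  assume "partial_ball I t D A \<inter> partial_ball I t D' A' \<noteq> {}"
  then obtain W where W: "card (sym_diff W A \<inter> D) \<le> t" "card (sym_diff W A' \<inter> D') \<le> t"
    unfolding partial_ball_def by auto
  have "finite D" "finite D'"
    using assms finite_subset by blast+
  then have "card (sym_diff A A' \<inter> D \<inter> D') \<le> card ((sym_diff W A \<inter> D) \<union> (sym_diff W A' \<inter> D'))"
    by (intro card_mono) auto
  also have "\<dots> \<le> card (sym_diff W A \<inter> D) + card (sym_diff W A' \<inter> D')"
    by (rule card_Un_le)
  finally show False
    using W far by simp
qed

lemma partial_word_packing:
  assumes "finite V" and "finite I"
    and D: "\<And>v. v \<in> V \<Longrightarrow> D v \<subseteq> I" and A: "\<And>v. v \<in> V \<Longrightarrow> A v \<subseteq> D v"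
    and far: "\<And>u v. u \<in> V \<Longrightarrow> v \<in> V \<Longrightarrow> u \<noteq> v \<Longrightarrow>
      2 * t < card (sym_diff (A u) (A v) \<inter> D u \<inter> D v)"
  shows "(\<Sum>v\<in>V. binomial_tail t (card (D v))) \<le> 1"
proof -
  let ?B = "\<lambda>v. partial_ball I t (D v) (A v)"
  have fin: "finite (?B v)" for v
    using assms(2) by (simp add: partial_ball_def)
  have "2 ^ card I * (\<Sum>v\<in>V. binomial_tail t (card (D v))) \<le> (\<Sum>v\<in>V. real (card (?B v)))"
    unfolding sum_distrib_left
    by (intro sum_mono card_partial_ball_ge assms(2) D A)
  also have "\<dots> = real (card (\<Union>v\<in>V. ?B v))"
    unfolding of_nat_sum[symmetric]
    by (subst card_UN_disjoint)
      (use assms(1) fin partial_balls_disjoint[OF assms(2) D D far] in auto)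
  also have "\<dots> \<le> real (card (Pow I))"
    using assms(2) by (intro of_nat_mono card_mono) (auto simp: partial_ball_def)
  also have "\<dots> = 2 ^ card I * 1"
    using assms(2) by (simp add: card_Pow)
  finally show ?thesis
    by (simp only: mult_le_cancel_left_pos zero_less_power zero_less_numeral)
qed

section \<open>Capacity bounds\<close>

lemma bipartite_graph_edge_bound:
  assumes "bipartite_graph H"
  shows "4 * card (gedges H) \<le> card (gverts H) ^ 2"
proof -
  obtain A B where AB: "A \<union> B = gverts H" "A \<inter> B = {}"
    "\<forall>e\<in>gedges H. \<exists>a\<in>A. \<exists>b\<in>B. e = {a, b}"
    using assms unfolding bipartite_graph_def by auto
  have fin: "finite A" "finite B"
    using assms AB(1) unfolding bipartite_graph_def simple_graph_def by (metis finite_Un)+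
  have "gedges H \<subseteq> (\<lambda>(a, b). {a, b}) ` (A \<times> B)"
    using AB(3) by fast
  then have "card (gedges H) \<le> card (A \<times> B)"
    using fin by (meson card_image_le card_mono finite_SigmaI finite_imageI le_trans)
  then have "card (gedges H) \<le> card A * card B"
    by (simp add: card_cartesian_product)
  moreover have "card (gverts H) = card A + card B"
    using AB fin card_Un_disjoint by metis
  moreover have "4 * (int a * int b) \<le> (int a + int b)^2" for a b
    using zero_le_power2[of "int a - int b"] by (simp add: power2_eq_square algebra_simps)
  then have "4 * (card A * card B) \<le> (card A + card B)^2"
    by (metis of_nat_add of_nat_le_iff of_nat_mult of_nat_numeral of_nat_power)
  ultimately show ?thesis
    by simp
qed

lemma bipartite_covering_completeD:
  assumes "bipartite_covering (complete_multigraph V l) m H"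
  shows "\<And>i. i \<in> {1..m} \<Longrightarrow> bipartite_graph (H i)"
    and "\<And>i. i \<in> {1..m} \<Longrightarrow> gverts (H i) \<subseteq> V"
    and "\<And>e. e \<in> [V]\<^bsup>2\<^esup> \<Longrightarrow> l \<le> card {i\<in>{1..m}. e \<in> gedges (H i)}"
  using assms unfolding bipartite_covering_def complete_multigraph_def by auto

lemma capacity_ge_linear:
  assumes "finite V" and "card V \<ge> 1"
    and cov: "bipartite_covering (complete_multigraph V l) m H"
  shows "2 * l * (card V - 1) \<le> capacity m H"
proof -
  let ?n = "card V"
  note cov = bipartite_covering_completeD[OF cov]
  have fin: "finite ([V]\<^bsup>2\<^esup>)"
    using assms(1) by (rule finite_imp_finite_nsets)
  \<comment> \<open>Only one factor of the square is relaxed to \<open>?n\<close>; the other must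
    survive to sum to the capacity.\<close>
  have edges: "4 * card (gedges (H i)) \<le> card (gverts (H i)) * ?n" if "i \<in> {1..m}" for i
  proof -
    have "card (gverts (H i)) \<le> ?n"
      using cov(2)[OF that] assms(1) card_mono by blast
    then have "card (gverts (H i)) ^ 2 \<le> card (gverts (H i)) * ?n"
      by (simp add: power2_eq_square)
    then show ?thesis
      using bipartite_graph_edge_bound[OF cov(1)[OF that]] by linarith
  qed
  have "(?n choose 2) * l \<le> (\<Sum>e\<in>[V]\<^bsup>2\<^esup>. card {i\<in>{1..m}. e \<in> gedges (H i)})"
    using sum_bounded_below[of "[V]\<^bsup>2\<^esup>" l] cov(3) by (simp add: card_nsets)
  also have "\<dots> = (\<Sum>i\<in>{1..m}. card {e\<in>[V]\<^bsup>2\<^esup>. e \<in> gedges (H i)})"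
    using fin by (intro sum_multicount_gen) auto
  also have "\<dots> = (\<Sum>i\<in>{1..m}. card (gedges (H i)))"
  proof (rule sum.cong[OF refl])
    fix i assume "i \<in> {1..m}"
    then have "gedges (H i) \<subseteq> [V]\<^bsup>2\<^esup>"
      using cov(1,2) unfolding bipartite_graph_def simple_graph_def
      by (meson nsets_mono order_trans)
    then show "card {e\<in>[V]\<^bsup>2\<^esup>. e \<in> gedges (H i)} = card (gedges (H i))"
      by (intro arg_cong[where f = card]) auto
  qed
  finally have "4 * ((?n choose 2) * l) \<le> (\<Sum>i\<in>{1..m}. 4 * card (gedges (H i)))"
    by (simp flip: sum_distrib_left)
  also have "\<dots> \<le> (\<Sum>i\<in>{1..m}. card (gverts (H i)) * ?n)"
    by (rule sum_mono) (rule edges)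
  also have "\<dots> = capacity m H * ?n"
    by (simp add: capacity_def sum_distrib_right)
  finally have "4 * ((?n choose 2) * l) \<le> capacity m H * ?n" .
  moreover have "4 * ((?n choose 2) * l) = 2 * l * (2 * (?n choose 2))"
    by simp
  \<comment> \<open>Parity makes the integer division in \<open>choose_two\<close> exact.\<close>
  moreover have "even ((?n - 1) * ?n)"
    by (cases "even ?n") auto
  then have "2 * (?n choose 2) = (?n - 1) * ?n"
    by (simp add: choose_two mult.commute)
  ultimately have "2 * l * (?n - 1) * ?n \<le> capacity m H * ?n"
    by (simp only: mult.assoc)
  then show ?thesis
    using assms(2) by simp
qed

section \<open>The logarithmic bound by packing words\<close>

lemma capacity_eq_sum_degree:
  assumes "finite V" and "\<And>i. i \<in> {1..m} \<Longrightarrow> gverts (H i) \<subseteq> V"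
  shows "capacity m H = (\<Sum>v\<in>V. card {i\<in>{1..m}. v \<in> gverts (H i)})"
proof -
  have "(\<Sum>v\<in>V. card {i\<in>{1..m}. v \<in> gverts (H i)}) =
      (\<Sum>i\<in>{1..m}. card {v\<in>V. v \<in> gverts (H i)})"
    using assms(1) by (intro sum_multicount_gen) auto
  also have "\<dots> = (\<Sum>i\<in>{1..m}. card (gverts (H i)))"
    using assms(2) by (intro sum.cong refl arg_cong[where f = card]) auto
  finally show ?thesis
    by (simp add: capacity_def)
qed

lemma covering_binomial_tail:
  assumes "finite V" and "2 * t < l"
    and cov: "bipartite_covering (complete_multigraph V l) m H"
  shows "(\<Sum>v\<in>V. binomial_tail t (card {i\<in>{1..m}. v \<in> gverts (H i)})) \<le> 1"
proof -
  note cov = bipartite_covering_completeD[OF cov]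
  let ?D = "\<lambda>v. {i\<in>{1..m}. v \<in> gverts (H i)}"
  \<comment> \<open>Keeping one side and taking the other as its complement lets a single function
    \<open>S\<close> choose all bipartitions.\<close>
  have "\<forall>i\<in>{1..m}. \<exists>A. A \<subseteq> gverts (H i) \<and>
      (\<forall>e\<in>gedges (H i). \<exists>a\<in>A. \<exists>b\<in>gverts (H i) - A. e = {a, b})"
  proof
    fix i assume "i \<in> {1..m}"
    then obtain A B where "A \<union> B = gverts (H i)" "A \<inter> B = {}"
      "\<forall>e\<in>gedges (H i). \<exists>a\<in>A. \<exists>b\<in>B. e = {a, b}"
      using cov(1) unfolding bipartite_graph_def by metis
    moreover from this have "B = gverts (H i) - A" by auto
    ultimately show "\<exists>A. A \<subseteq> gverts (H i) \<and>
      (\<forall>e\<in>gedges (H i). \<exists>a\<in>A. \<exists>b\<in>gverts (H i) - A. e = {a, b})"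
      by blast
  qed
  then obtain S where S: "\<And>i. i \<in> {1..m} \<Longrightarrow> S i \<subseteq> gverts (H i)"
    "\<And>i e. i \<in> {1..m} \<Longrightarrow> e \<in> gedges (H i) \<Longrightarrow> \<exists>a\<in>S i. \<exists>b\<in>gverts (H i) - S i. e = {a, b}"
    by metis
  let ?A = "\<lambda>v. {i\<in>{1..m}. v \<in> S i}"
  show ?thesis
  proof (rule partial_word_packing[where I = "{1..m}" and A = ?A])
    fix u v assume uv: "u \<in> V" "v \<in> V" "u \<noteq> v"
    have "{i\<in>{1..m}. {u, v} \<in> gedges (H i)} \<subseteq> sym_diff (?A u) (?A v) \<inter> ?D u \<inter> ?D v"
    proof
      fix i assume i: "i \<in> {i\<in>{1..m}. {u, v} \<in> gedges (H i)}"
      then obtain a b where ab: "a \<in> S i" "b \<in> gverts (H i) - S i" "{u, v} = {a, b}"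
        using S(2)[of i "{u, v}"] by auto
      moreover have "a \<in> gverts (H i)"
        using S(1)[of i] i ab(1) by auto
      moreover have "u = a \<and> v = b \<or> u = b \<and> v = a"
        using ab(3) by (auto simp: doubleton_eq_iff)
      ultimately show "i \<in> sym_diff (?A u) (?A v) \<inter> ?D u \<inter> ?D v"
        using i by auto
    qed
    then have "card {i\<in>{1..m}. {u, v} \<in> gedges (H i)} \<le>
        card (sym_diff (?A u) (?A v) \<inter> ?D u \<inter> ?D v)"
      by (intro card_mono) auto
    moreover have "{u, v} \<in> [V]\<^bsup>2\<^esup>"
      using uv by (auto simp: nsets_def)
    ultimately show "2 * t < card (sym_diff (?A u) (?A v) \<inter> ?D u \<inter> ?D v)"
      using cov(3)[of "{u, v}"] assms(2) by linarith
  qed (use S(1) assms(1) in auto)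
qed

text \<open>Any single edge at \<open>v\<close> already lies in \<open>l\<close> graphs. This places
  all degrees in the convex range and bounds their average below by \<open>l\<close>.\<close>

lemma covering_degree_ge:
  assumes "finite V" and "card V \<ge> 2" and "v \<in> V"
    and cov: "bipartite_covering (complete_multigraph V l) m H"
  shows "l \<le> card {i\<in>{1..m}. v \<in> gverts (H i)}"
proof -
  note cov = bipartite_covering_completeD[OF cov]
  have "\<not> V \<subseteq> {v}"
    using assms(2) card_mono[of "{v}" V] by auto
  then obtain u where u: "u \<in> V" "u \<noteq> v"
    by auto
  then have "{u, v} \<in> [V]\<^bsup>2\<^esup>"
    using assms(3) by (auto simp: nsets_def)
  then have "l \<le> card {i\<in>{1..m}. {u, v} \<in> gedges (H i)}"
    by (rule cov(3))
  also have "\<dots> \<le> card {i\<in>{1..m}. v \<in> gverts (H i)}"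
  proof (rule card_mono)
    show "{i\<in>{1..m}. {u, v} \<in> gedges (H i)} \<subseteq> {i\<in>{1..m}. v \<in> gverts (H i)}"
      using cov(1) unfolding bipartite_graph_def simple_graph_def nsets_def by blast
  qed simp
  finally show ?thesis .
qed

lemma capacity_ge_log:
  assumes "finite V" and n: "card V \<ge> 2" and t: "2 * t < l"
    and cov: "bipartite_covering (complete_multigraph V l) m H"
  shows "real (card V) * (log 2 (card V) + real t * log 2 (log 2 (card V) / l) - 1)
    \<le> capacity m H"
proof -
  let ?n = "real (card V)" and ?L = "log 2 (card V)"
  let ?d = "\<lambda>v. card {i\<in>{1..m}. v \<in> gverts (H i)}"
  define k where "k = capacity m H div card V"
  have cap: "capacity m H = (\<Sum>v\<in>V. ?d v)"
    using capacity_eq_sum_degree assms(1) bipartite_covering_completeD(2)[OF cov] by blast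
  have d: "l \<le> ?d v" if "v \<in> V" for v
    using covering_degree_ge[OF assms(1) n that cov] .
  have "?n * binomial_tail t (Suc k) \<le> (\<Sum>v\<in>V. binomial_tail t (?d v))"
  proof (rule card_mult_binomial_tail_le_sum)
    show "2 * t \<le> ?d v" if "v \<in> V" for v
      using d[OF that] t by linarith
  qed (use assms(1) n k_def cap in auto)
  also have "\<dots> \<le> 1"
    using covering_binomial_tail[OF assms(1) t cov] .
  finally have main: "?n * (\<Sum>j\<le>t. real (Suc k choose j)) \<le> 2 ^ Suc k"
    unfolding binomial_tail_def by (simp add: field_simps)
  have "card V * l \<le> capacity m H"
    unfolding cap using sum_bounded_below[of V l ?d] d by simp
  then have "l \<le> k"
    unfolding k_def using n by (simp add: less_eq_div_iff_mult_less_eq mult.commute)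
  have L: "?L \<ge> 1"
    using n by (simp add: le_log_iff)
  \<comment> \<open>The term \<open>j = 0\<close> alone gives log n \<le> k + 1; this crude bound is
    then fed into the term \<open>j = t\<close>.\<close>
  have "?n * 1 \<le> ?n * (\<Sum>j\<le>t. real (Suc k choose j))"
    using member_le_sum[of 0 "{..t}" "\<lambda>j. real (Suc k choose j)"] by (intro mult_left_mono) auto
  then have "?n \<le> 2 ^ Suc k"
    using main by linarith
  moreover have pow: "2 ^ Suc k = 2 powr real (Suc k)"
    by (simp only: powr_realpow zero_less_numeral)
  ultimately have Lk: "?L \<le> real (Suc k)"
    using n by (subst log_le_iff) simp_all
  have "(?L / l) ^ t \<le> real (Suc k choose t)"
  \<comment> \<open>The comparison of quotients needs a positive \<open>t\<close>; for
    \<open>t = 0\<close> both sides are 1.\<close>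
  proof (cases "t = 0")
    case False
    have "?L / l \<le> real (Suc k) / real t"
      using Lk L t False by (intro frac_le) auto
    then have "(?L / l) ^ t \<le> (real (Suc k) / real t) ^ t"
      using L by (intro power_mono) auto
    also have "\<dots> \<le> real (Suc k choose t)"
      using binomial_ge_n_over_k_pow_k[of t "Suc k", where 'a = real] t \<open>l \<le> k\<close> by simp
    finally show ?thesis .
  qed simp
  also have "\<dots> \<le> (\<Sum>j\<le>t. real (Suc k choose j))"
    by (rule member_le_sum) auto
  finally have "?n * (?L / l) ^ t \<le> ?n * (\<Sum>j\<le>t. real (Suc k choose j))"
    by (rule mult_left_mono) simp
  then have "?n * (?L / l) ^ t \<le> 2 ^ Suc k"
    using main by linarith
  moreover have pos: "?n > 0" "?L / l > 0"
    using n L t by auto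
  ultimately have "log 2 (?n * (?L / l) ^ t) \<le> real (Suc k)"
    unfolding pow by (subst log_le_iff) simp_all
  then have "?L + real t * log 2 (?L / l) - 1 \<le> real k"
    using pos by (simp add: log_mult_pos log_nat_power)
  then have "?n * (?L + real t * log 2 (?L / l) - 1) \<le> ?n * real k"
    using pos by (intro mult_left_mono) auto
  also have "\<dots> \<le> capacity m H"
    unfolding k_def by (metis of_nat_le_iff of_nat_mult times_div_less_eq_dividend)
  finally show ?thesis .
qed

theorem theorem1p3:
  fixes n l m :: nat and V :: "'a set" and H :: "nat \<Rightarrow> 'a graph"
  assumes "n \<ge> 1" and "l \<ge> 1"
    and "finite V" and "card V = n"
    and "bipartite_covering (complete_multigraph V l) m H"
  shows "real (capacity m H) \<ge>
    max (2 * real l * (real n - 1))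
        (real n * (log 2 (real n)
           + real_of_int \<lfloor>(real l - 1) / 2\<rfloor> * log 2 (log 2 (real n) / real l)
           - real l - 1))"
proof (rule max.boundedI)
  have "2 * l * (n - 1) \<le> capacity m H"
    using capacity_ge_linear assms by blast
  then have "real (2 * l * (n - 1)) \<le> real (capacity m H)"
    by (rule of_nat_mono)
  then show "2 * real l * (real n - 1) \<le> real (capacity m H)"
    using assms(1) by (simp add: of_nat_diff)
next
  \<comment> \<open>The largest \<open>t\<close> with \<open>2 * t < l\<close>, and equal to the
    real floor since \<open>l\<close> is positive.\<close>
  define t where "t = (l - 1) div 2"
  have "real_of_int \<lfloor>(real l - 1) / 2\<rfloor> = real t"
    using assms(2) floor_divide_of_nat_eq[of "l - 1" 2, where 'a = real]
    by (simp add: t_def of_nat_diff)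
  moreover have "2 * t < l"
    using assms(2) by (simp add: t_def)
  moreover have "real n * (log 2 n + real t * log 2 (log 2 n / l) - l - 1) \<le> capacity m H"
  proof (cases "n = 1")
    case False
    \<comment> \<open>The packing bound holds even without the term \<open>- l\<close>.\<close>
    have "real n * (log 2 n + real t * log 2 (log 2 n / l) - l - 1) \<le>
        real n * (log 2 n + real t * log 2 (log 2 n / l) - 1)"
      by (rule mult_left_mono) auto
    also have "\<dots> \<le> capacity m H"
      using capacity_ge_log[of V t l m H] \<open>2 * t < l\<close> assms False by simp
    finally show ?thesis .
  \<comment> \<open>For \<open>n = 1\<close> the inner logarithm is taken at 0, where its value is 0
    by convention, so the left side is \<open>- l - 1\<close>.\<close>
  qed (simp add: log_def)
  ultimately show "real n * (log 2 (real n)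
      + real_of_int \<lfloor>(real l - 1) / 2\<rfloor> * log 2 (log 2 (real n) / real l)
      - real l - 1) \<le> real (capacity m H)"
    by simp
qed

end
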